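(* Let $\mathcal{A}$ be a finite-dimensional descendingly alternative algebra over an arbitrary field $\mathbb{F}$, let $S \subseteq \mathcal{A}$, and let $w \in S^{(m)}$ for some $m \geq 2$. Then: (1) There exists a word $xy = (((x_1 x_2) \dots) x_k) \cdot (y_{m-k} (\dots (y_2 y_1)))$ with $1 \leq k \leq m-1$ and letters $x_i, y_j\in S$, such that $w \sim \pm xy$. (2) There are at most two classes of pairwise swappable letters in $xy$; namely, the letters $y_1, x_2, \dots, x_k$ are pairwise swappable, and the letters $x_1, y_2, \dots, y_{m-k}$ are pairwise swappable.
   Context: $\mathcal{A}$ is possibly non-unital and non-associative. If $\mathcal{A}$ is unital, its unity is denoted by $e$. For $a,b,c\in\mathcal{A}$ let $\mathcal{L}'_2(a,b,c)$ be the span of $a,b,c,ab,ba,cb,bc,ac,ca$ (together with $e$ if $\mathcal{A}$ is unital), and let $\mathcal{L}_1(a,b,aa,ab,ba)$ be the span of $a,b,aa,ab,ba$ (together with $e$ if $\mathcal{A}$ is unital). $\mathcal{A}$ is descendingly alternative if for all $a,b,c\in\mathcal{A}$: $(ba)a,\ a(ab) \in \mathcal{L}_1(a,b,aa,ab,ba)$; $(ab)c+(ac)b\in\mathcal{L}'_2(a,b,c)$; and $a(bc)+b(ac)\in\mathcal{L}'_2(a,b,c)$. Words. A word of length $k\ge1$ in $S$ is a product of $k$ elements (letters) of $S$ with some arrangement of brackets; $e$ is a word of length $0$ if $\mathcal{A}$ is unital, otherwise there are no words of length $0$. Words are regarded as bracketed expressions, also identified with their values in $\mathcal{A}$; the length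 $l(x)$ of a word $x$ is the number of letters in its notation, and letters in a word are regarded as occurrences. $S^k$ is the set of words of length at most $k$, $S^\infty=\bigcup_k S^k$, $\pm S^\infty$ is the set of words with a sign $+$ or $-$ (with the same lengths), and $\mathcal{L}_k(S)$ is the linear span of $S^k$. $L_a(x)=ax$ and $R_a(x)=xa$. $S^{(m)}$ is defined by $S^{(1)}=S$, $S^{(k+1)}=S^{(k)}\cdot S\cup S\cdot S^{(k)}$ (sets of products), i.e. $S^{(m)}$ consists of the words $X_1X_2\cdots X_{m-1}s_m$ with $X_i\in\{L_{s_i},R_{s_i}\}$ and $s_1,\dots,s_m\in S$. Equivalence. For $x,y\in\pm S^\infty$ with $l(x)=l(y)=m\ge1$, write $x\sim y$ if $x-y\in\mathcal{L}_{m-1}(S)$. Formal equivalence (for descendingly alternative $\mathcal{A}$). Elementary equivalences are defined inductively: for words $a,b,c$ of length $\ge1$, $(ab)c\sim-(ac)b$ and $a(bc)\sim-b(ac)$ are elementary; if $u\sim v$ is elementary and $z\in S^\infty$, then $uz\sim vz$ and $zu\sim zv$ are elementary. Two signed words are formally equivalent if they are connected by a chain of elementary equivalences. Swappability (for descendingly alternative $\mathcal{A}$). Two letters (occurrences) $s,t$ of a word $x$ are swappable if $x$ is formally equivalent to some (signed) word of the form $\dots R_sR_t\dots$ or of the form $\dots L_sL_t\dots$, i.e. one containing a subword $R_sR_t(v)=(vt)s$ or $L_sL_t(v)=s(tv)$ for some nonempty word $v$; here the occurrences of letters are tracked through the elementary equivalences. Classes of pairwise swappable letters are the corresponding sets of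 letters of the word in which any two distinct letters are swappable. *)

theory Defs
  imports Complex_Main
begin

locale nonassoc_algebra = vector_space scale
  for scale :: "'f::field \<Rightarrow> 'a::ab_group_add \<Rightarrow> 'a" +
  fixes mult :: "'a \<Rightarrow> 'a \<Rightarrow> 'a"
  assumes linear_mult_right: "Vector_Spaces.linear scale scale (\<lambda>x. mult a x)"
    and linear_mult_left: "Vector_Spaces.linear scale scale (\<lambda>x. mult x a)"

text \<open>The set of unities is empty or a singleton, so adjoining it to a set means adjoining the
  unity exactly when the algebra is unital.\<close>

definition unity :: "('a \<Rightarrow> 'a \<Rightarrow> 'a) \<Rightarrow> 'a set" where
  "unity mult = {e. \<forall>a. mult e a = a \<and> mult a e = a}"

definition unital_span ::
  "('f::field \<Rightarrow> 'a::ab_group_add \<Rightarrow> 'a) \<Rightarrow> ('a \<Rightarrow> 'a \<Rightarrow> 'a) \<Rightarrow> 'a set \<Rightarrow> 'a set" where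
  "unital_span scale mult A = module.span scale (A \<union> unity mult)"

definition descendingly_alternative ::
  "('f::field \<Rightarrow> 'a::ab_group_add \<Rightarrow> 'a) \<Rightarrow> ('a \<Rightarrow> 'a \<Rightarrow> 'a) \<Rightarrow> bool" where
  "descendingly_alternative scale mult \<longleftrightarrow>
    (\<forall>a b c.
      let L1 = unital_span scale mult {a, b, mult a a, mult a b, mult b a};
          L2 = unital_span scale mult
                 {a, b, c, mult a b, mult b a, mult c b, mult b c, mult a c, mult c a}
      in mult (mult b a) a \<in> L1 \<and> mult a (mult a b) \<in> L1
         \<and> mult (mult a b) c + mult (mult a c) b \<in> L2
         \<and> mult a (mult b c) + mult b (mult a c) \<in> L2)"

text \<open>Words of length at least 1, as bracketed expressions. The word of length 0 has no
  representation here; it only enters through the unity in the spans below.\<close>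

datatype (letters: 'a) bword = Letter 'a | Prod "'a bword" "'a bword" (infixl "\<odot>" 70)

primrec len :: "'a bword \<Rightarrow> nat" where
  "len (Letter a) = 1"
| "len (u \<odot> v) = len u + len v"

primrec val :: "('a \<Rightarrow> 'a \<Rightarrow> 'a) \<Rightarrow> 'a bword \<Rightarrow> 'a" where
  "val mult (Letter a) = a"
| "val mult (u \<odot> v) = mult (val mult u) (val mult v)"

primrec subwords :: "'a bword \<Rightarrow> 'a bword set" where
  "subwords (Letter a) = {Letter a}"
| "subwords (u \<odot> v) = insert (u \<odot> v) (subwords u \<union> subwords v)"

datatype 'w signed = Plus (unsigned: 'w) | Minus (unsigned: 'w)

primrec sval :: "('a::ab_group_add \<Rightarrow> 'a \<Rightarrow> 'a) \<Rightarrow> 'a bword signed \<Rightarrow> 'a" where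
  "sval mult (Plus u) = val mult u"
| "sval mult (Minus u) = - val mult u"

text \<open>The span \<open>\<L>\<^sub>k(S)\<close> of all words of length at most \<open>k\<close>, including the unity as the word of
  length 0.\<close>

definition words_span ::
  "('f::field \<Rightarrow> 'a::ab_group_add \<Rightarrow> 'a) \<Rightarrow> ('a \<Rightarrow> 'a \<Rightarrow> 'a) \<Rightarrow> nat \<Rightarrow> 'a set \<Rightarrow> 'a set" where
  "words_span scale mult k S =
     unital_span scale mult (val mult ` {u. letters u \<subseteq> S \<and> len u \<le> k})"

text \<open>The relation \<open>u \<sim> v\<close>.\<close>

definition word_equiv ::
  "('f::field \<Rightarrow> 'a::ab_group_add \<Rightarrow> 'a) \<Rightarrow> ('a \<Rightarrow> 'a \<Rightarrow> 'a) \<Rightarrow> 'a set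
     \<Rightarrow> 'a bword signed \<Rightarrow> 'a bword signed \<Rightarrow> bool" where
  "word_equiv scale mult S u v \<longleftrightarrow>
     letters (unsigned u) \<subseteq> S \<and> letters (unsigned v) \<subseteq> S
     \<and> len (unsigned u) = len (unsigned v)
     \<and> sval mult u - sval mult v \<in> words_span scale mult (len (unsigned u) - 1) S"

text \<open>\<open>S\<^sup>(\<^sup>m\<^sup>)\<close>; the value at 0 is a dummy.\<close>

fun one_sided_words :: "'a set \<Rightarrow> nat \<Rightarrow> 'a bword set" where
  "one_sided_words S 0 = {}"
| "one_sided_words S (Suc 0) = Letter ` S"
| "one_sided_words S (Suc (Suc k)) =
     {u \<odot> Letter s |u s. u \<in> one_sided_words S (Suc k) \<and> s \<in> S}
     \<union> {Letter s \<odot> u |u s. u \<in> one_sided_words S (Suc k) \<and> s \<in> S}"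

text \<open>Both sides of an elementary equivalence have the same letters, so all words in a chain
  starting at a word in \<open>S\<close> are words in \<open>S\<close>, and no restriction to \<open>S\<close> is needed.
  Multiplying an elementary equivalence by the word of length 0 would not change it.\<close>

inductive elementary :: "'a bword signed \<Rightarrow> 'a bword signed \<Rightarrow> bool" where
  right_swap: "elementary (Plus ((a \<odot> b) \<odot> c)) (Minus ((a \<odot> c) \<odot> b))"
| left_swap: "elementary (Plus (a \<odot> (b \<odot> c))) (Minus (b \<odot> (a \<odot> c)))"
| mult_right: "elementary u v \<Longrightarrow>
    elementary (map_signed (\<lambda>x. x \<odot> z) u) (map_signed (\<lambda>x. x \<odot> z) v)"
| mult_left: "elementary u v \<Longrightarrow>
    elementary (map_signed (\<lambda>x. z \<odot> x) u) (map_signed (\<lambda>x. z \<odot> x) v)"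

definition formally_equiv :: "'a bword signed \<Rightarrow> 'a bword signed \<Rightarrow> bool" where
  "formally_equiv = equivclp elementary"

text \<open>Occurrences of letters in a word are its positions \<open>0, 1, \<dots>\<close>, counted from left to right.
  Pairing every letter with its position makes all letters distinct, so that elementary
  equivalences of the resulting words carry the original occurrences along.\<close>

primrec tag_from :: "nat \<Rightarrow> 'a bword \<Rightarrow> ('a \<times> nat) bword" where
  "tag_from n (Letter a) = Letter (a, n)"
| "tag_from n (u \<odot> v) = tag_from n u \<odot> tag_from (n + len u) v"

definition swappable :: "'a bword \<Rightarrow> nat \<Rightarrow> nat \<Rightarrow> bool" where
  "swappable x i j \<longleftrightarrow>
     (\<exists>u s t v. formally_equiv (Plus (tag_from 0 x)) u \<and> snd s = i \<and> snd t = j \<and>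
        ((v \<odot> Letter t) \<odot> Letter s \<in> subwords (unsigned u) \<or>
         Letter s \<odot> (Letter t \<odot> v) \<in> subwords (unsigned u)))"

definition pairwise_swappable :: "'a bword \<Rightarrow> nat set \<Rightarrow> bool" where
  "pairwise_swappable x C \<longleftrightarrow>
     C \<subseteq> {..<len x} \<and> (\<forall>i\<in>C. \<forall>j\<in>C. i \<noteq> j \<longrightarrow> swappable x i j)"

text \<open>Subsets of pairwise swappable sets are pairwise swappable, so only maximal sets are counted
  as classes.\<close>

definition swap_classes :: "'a bword \<Rightarrow> nat set set" where
  "swap_classes x =
     {C. pairwise_swappable x C \<and> (\<forall>D. pairwise_swappable x D \<and> C \<subseteq> D \<longrightarrow> D = C)}"

text \<open>\<open>((x\<^sub>1 x\<^sub>2) \<dots>) x\<^sub>k\<close> and \<open>y\<^sub>n (\<dots> (y\<^sub>2 y\<^sub>1))\<close> for \<open>k, n \<ge> 1\<close>.\<close>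

definition left_normed :: "(nat \<Rightarrow> 'a) \<Rightarrow> nat \<Rightarrow> 'a bword" where
  "left_normed x k = foldl (\<lambda>u a. u \<odot> Letter a) (Letter (x 1)) (map x [2..<Suc k])"

definition right_normed :: "(nat \<Rightarrow> 'a) \<Rightarrow> nat \<Rightarrow> 'a bword" where
  "right_normed y n = foldl (\<lambda>u a. Letter a \<odot> u) (Letter (y 1)) (map y [2..<Suc n])"

text \<open>The positions of the letters \<open>x\<^sub>i\<close> and \<open>y\<^sub>j\<close> in \<open>left_normed x k \<odot> right_normed y (m - k)\<close>,
  whose letters are, from left to right, \<open>x\<^sub>1, \<dots>, x\<^sub>k, y\<^sub>m\<^sub>-\<^sub>k, \<dots>, y\<^sub>1\<close>.\<close>

definition x_pos :: "nat \<Rightarrow> nat" where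
  "x_pos i = i - 1"

definition y_pos :: "nat \<Rightarrow> nat \<Rightarrow> nat" where
  "y_pos m j = m - j"

end

theory Submission
  imports Defs "HOL-Combinatorics.Transposition"
begin

text \<open>
  Up to formal equivalence, \<open>(XY)s\<close> becomes \<open>(Xs)Y\<close> and \<open>s(XY)\<close> becomes \<open>X(sY)\<close>, so by induction
  every one-sided word turns into a left-normed word times a right-normed one.  For the classes,
  exchanging two swappable letters of \<open>x\<close> gives a word that is again formally equivalent to \<open>x\<close>.
  Hence swappability is transitive, and it suffices to swap neighbouring letters of the two families,
  plus \<open>y\<^sub>1\<close> with \<open>x\<^sub>k\<close> and \<open>x\<^sub>1\<close> with \<open>y\<^sub>m\<^sub>-\<^sub>k\<close>, which become adjacent once all the other \<open>y\<^sub>j\<close>, respectively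
  all the other \<open>x\<^sub>i\<close>, are pulled out of the product.  An equivalence relation whose domain is covered
  by two cliques has at most two classes.
\<close>

section \<open>Swaps of unsigned words\<close>

text \<open>\<open>elementary\<close> with the signs dropped. The reverse of each generating rule is
  an instance of the same rule, so the relation is symmetric and its reflexive transitive closure is
  already an equivalence.\<close>

inductive swap_step :: "'a bword \<Rightarrow> 'a bword \<Rightarrow> bool" where
  swap_right: "swap_step ((a \<odot> b) \<odot> c) ((a \<odot> c) \<odot> b)"
| swap_left: "swap_step (a \<odot> (b \<odot> c)) (b \<odot> (a \<odot> c))"
| swap_mult_right: "swap_step u v \<Longrightarrow> swap_step (u \<odot> z) (v \<odot> z)"
| swap_mult_left: "swap_step u v \<Longrightarrow> swap_step (z \<odot> u) (z \<odot> v)"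

abbreviation swap_equiv :: "'a bword \<Rightarrow> 'a bword \<Rightarrow> bool" where
  "swap_equiv \<equiv> swap_step\<^sup>*\<^sup>*"

lemma swap_step_sym: "swap_step u v \<Longrightarrow> swap_step v u"
  by (induction rule: swap_step.induct) (auto intro: swap_step.intros)

lemma swap_equiv_sym: "swap_equiv u v \<Longrightarrow> swap_equiv v u"
  by (induction rule: rtranclp_induct)
    (auto intro: swap_step_sym converse_rtranclp_into_rtranclp)

lemma unsigned_map_signed [simp]: "unsigned (map_signed f p) = f (unsigned p)"
  by (cases p) auto

lemma elementary_imp_swap_step: "elementary p q \<Longrightarrow> swap_step (unsigned p) (unsigned q)"
  by (induction rule: elementary.induct) (auto intro: swap_step.intros)

text \<open>\<open>map_signed\<close> keeps the sign, so the pattern from \<open>Plus\<close> to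
  \<open>Minus\<close> of the two generating rules survives multiplication by further words.\<close>

lemma swap_step_imp_elementary: "swap_step u v \<Longrightarrow> elementary (Plus u) (Minus v)"
proof (induction rule: swap_step.induct)
  case (swap_mult_right u v z)
  then show ?case
    using elementary.mult_right[of "Plus u" "Minus v" z] by simp
next
  case (swap_mult_left u v z)
  then show ?case
    using elementary.mult_left[of "Plus u" "Minus v" z] by simp
qed (rule elementary.intros)+

text \<open>Signs can be restored along any chain of swaps, because every elementary equivalence
  just flips the sign. Hence swappability can be studied without signs.\<close>

lemma swap_equiv_iff_formally_equiv:
  "swap_equiv u v \<longleftrightarrow> (\<exists>p. formally_equiv (Plus u) p \<and> unsigned p = v)"
proof
  assume "swap_equiv u v"
  then show "\<exists>p. formally_equiv (Plus u) p \<and> unsigned p = v"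
  proof (induction rule: rtranclp_induct)
    case base
    show ?case
      by (rule exI[of _ "Plus u"]) (simp add: formally_equiv_def)
  next
    case (step y z)
    then obtain p where p: "formally_equiv (Plus u) p" "unsigned p = y"
      by blast
    show ?case
    proof (cases p)
      case (Plus y')
      then have "elementary p (Minus z)"
        using p step.hyps swap_step_imp_elementary by auto
      then have "formally_equiv (Plus u) (Minus z)"
        using p unfolding formally_equiv_def by (meson equivclp_into_equivclp)
      then show ?thesis
        by force
    next
      case (Minus y')
      \<comment> \<open>Elementary equivalences lead only from \<open>Plus\<close> to
        \<open>Minus\<close>. A step out of a negative word is therefore the reversed swap, read
        backwards in \<open>equivclp\<close>.\<close>
      then have "elementary (Plus z) p"
        using p step.hyps swap_step_imp_elementary swap_step_sym by auto
      then have "formally_equiv (Plus u) (Plus z)"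
        using p unfolding formally_equiv_def by (meson equivclp_into_equivclp)
      then show ?thesis
        by force
    qed
  qed
next
  assume "\<exists>p. formally_equiv (Plus u) p \<and> unsigned p = v"
  then obtain p where p: "equivclp elementary (Plus u) p" and v: "unsigned p = v"
    unfolding formally_equiv_def by blast
  from p have "swap_equiv (unsigned (Plus u)) (unsigned p)"
  proof (induction rule: equivclp_induct)
    case base
    show ?case
      by simp
  next
    case (step q r)
    then have "swap_step (unsigned q) (unsigned r)"
      using elementary_imp_swap_step swap_step_sym by blast
    with step.IH show ?case
      by (rule rtranclp.rtrancl_into_rtrancl)
  qed
  then show "swap_equiv u v"
    using v by simp
qed

lemma swap_equiv_mult_right: "swap_equiv u v \<Longrightarrow> swap_equiv (u \<odot> z) (v \<odot> z)"
  by (induction rule: rtranclp_induct)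
    (auto intro: swap_mult_right rtranclp.rtrancl_into_rtrancl)

lemma swap_equiv_mult_left: "swap_equiv u v \<Longrightarrow> swap_equiv (z \<odot> u) (z \<odot> v)"
  by (induction rule: rtranclp_induct)
    (auto intro: swap_mult_left rtranclp.rtrancl_into_rtrancl)

lemma swap_step_map: "swap_step u v \<Longrightarrow> swap_step (map_bword f u) (map_bword f v)"
  by (induction rule: swap_step.induct) (auto intro: swap_step.intros)

lemma swap_equiv_map: "swap_equiv u v \<Longrightarrow> swap_equiv (map_bword f u) (map_bword f v)"
  by (induction rule: rtranclp_induct)
    (auto intro: swap_step_map rtranclp.rtrancl_into_rtrancl)

lemma swap_step_letters: "swap_step u v \<Longrightarrow> letters u = letters v"
  by (induction rule: swap_step.induct) auto

lemma swap_equiv_letters: "swap_equiv u v \<Longrightarrow> letters u = letters v"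
  by (induction rule: rtranclp_induct) (auto dest: swap_step_letters)

text \<open>Satisfied by tagged words. It ensures that transposing two labels changes a word only at
  the two occurrences concerned.\<close>

primrec distinct_letters :: "'a bword \<Rightarrow> bool" where
  "distinct_letters (Letter a) \<longleftrightarrow> True"
| "distinct_letters (u \<odot> v) \<longleftrightarrow>
     distinct_letters u \<and> distinct_letters v \<and> letters u \<inter> letters v = {}"

lemma swap_step_distinct_letters: "swap_step u v \<Longrightarrow> distinct_letters u \<Longrightarrow> distinct_letters v"
  by (induction rule: swap_step.induct) (auto dest: swap_step_letters)

lemma swap_equiv_distinct_letters: "swap_equiv u v \<Longrightarrow> distinct_letters u \<Longrightarrow> distinct_letters v"
  by (induction rule: rtranclp_induct) (auto dest: swap_step_distinct_letters)

section \<open>Adjacent letters\<close>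

text \<open>The pattern from \<open>swappable\<close>, required of \<open>u\<close> itself and
  stated for letters rather than positions, so that it can be carried along a relabelling.\<close>

definition adjacent :: "'a bword \<Rightarrow> 'a \<Rightarrow> 'a \<Rightarrow> bool" where
  "adjacent u s t \<longleftrightarrow>
     (\<exists>v. (v \<odot> Letter t) \<odot> Letter s \<in> subwords u \<or> Letter s \<odot> (Letter t \<odot> v) \<in> subwords u)"

lemma self_in_subwords [simp]: "u \<in> subwords u"
  by (cases u) auto

lemma letters_subwords: "u \<in> subwords w \<Longrightarrow> letters u \<subseteq> letters w"
  by (induction w) auto

lemma subwords_trans: "u \<in> subwords v \<Longrightarrow> v \<in> subwords w \<Longrightarrow> u \<in> subwords w"
  by (induction w) auto

lemma distinct_letters_subwords: "u \<in> subwords w \<Longrightarrow> distinct_letters w \<Longrightarrow> distinct_letters u"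
  by (induction w) auto

lemma map_subwords: "u \<in> subwords w \<Longrightarrow> map_bword f u \<in> subwords (map_bword f w)"
  by (induction w) auto

lemma adjacent_letters: "adjacent u s t \<Longrightarrow> s \<in> letters u \<and> t \<in> letters u"
  unfolding adjacent_def by (auto dest: letters_subwords)

lemma adjacent_neq: "adjacent u s t \<Longrightarrow> distinct_letters u \<Longrightarrow> s \<noteq> t"
  unfolding adjacent_def by (auto dest: distinct_letters_subwords)

lemma adjacent_subwords: "adjacent u s t \<Longrightarrow> u \<in> subwords w \<Longrightarrow> adjacent w s t"
  unfolding adjacent_def by (meson subwords_trans)

lemma adjacent_map: "adjacent u s t \<Longrightarrow> adjacent (map_bword f u) (f s) (f t)"
  unfolding adjacent_def by (force dest: map_subwords[of _ _ f])

lemma map_transpose_id: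
  "s \<notin> letters u \<Longrightarrow> t \<notin> letters u \<Longrightarrow> map_bword (transpose s t) u = u"
  by (rule bword.map_ident_strong) (auto simp: transpose_def)

text \<open>One swap at the pattern exchanges \<open>s\<close> and \<open>t\<close>. As neither
  occurs elsewhere, the effect is the same as relabelling the whole word by the
  transposition.\<close>

lemma adjacent_swap_step:
  assumes "adjacent u s t" and "distinct_letters u"
  shows "swap_step u (map_bword (transpose s t) u)"
  using assms
proof (induction u)
  case (Letter a)
  then show ?case
    by (simp add: adjacent_def)
next
  case (Prod u1 u2)
  \<comment> \<open>The pattern is the whole word or lies inside one factor; in the latter case the
    other factor contains neither letter and is fixed by the transposition.\<close>
  consider v where "u1 \<odot> u2 = (v \<odot> Letter t) \<odot> Letter s"
    | v where "u1 \<odot> u2 = Letter s \<odot> (Letter t \<odot> v)"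
    | "adjacent u1 s t" | "adjacent u2 s t"
    using Prod.prems(1) unfolding adjacent_def by auto
  then show ?case
  proof cases
    case 1
    then show ?thesis
      using Prod.prems(2) by (auto simp: map_transpose_id intro: swap_right)
  next
    case 2
    then show ?thesis
      using Prod.prems(2) by (auto simp: map_transpose_id intro: swap_left)
  next
    case 3
    then have "map_bword (transpose s t) u2 = u2"
      using Prod.prems(2) adjacent_letters[OF 3] by (intro map_transpose_id) auto
    then show ?thesis
      using Prod 3 by (simp add: swap_mult_right)
  next
    case 4
    then have "map_bword (transpose s t) u1 = u1"
      using Prod.prems(2) adjacent_letters[OF 4] by (intro map_transpose_id) auto
    then show ?thesis
      using Prod 4 by (simp add: swap_mult_left)
  qed
qed

text \<open>Both ends of \<open>swap_equiv w u\<close> may be relabelled, and \<open>u\<close> is one swap away from its relabelling.\<close>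

lemma adjacent_transpose_equiv:
  assumes "swap_equiv w u" and "adjacent u s t" and "distinct_letters w"
  shows "swap_equiv w (map_bword (transpose s t) w)"
proof -
  let ?f = "map_bword (transpose s t)"
  have "swap_step u (?f u)"
    using assms(2) swap_equiv_distinct_letters[OF assms(1,3)] by (rule adjacent_swap_step)
  with assms(1) have "swap_equiv w (?f u)"
    by (rule rtranclp.rtrancl_into_rtrancl)
  also have "swap_equiv (?f u) (?f w)"
    by (rule swap_equiv_map[OF swap_equiv_sym[OF assms(1)]])
  finally show ?thesis .
qed

section \<open>Swappability is an equivalence relation\<close>

lemma letters_tag: "s \<in> letters (tag_from n u) \<Longrightarrow> n \<le> snd s \<and> snd s < n + len u"
  by (induction u arbitrary: n) fastforce+

lemma distinct_letters_tag: "distinct_letters (tag_from n u)"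
  by (induction u arbitrary: n) (fastforce dest: letters_tag)+

lemma tag_inj:
  "s \<in> letters (tag_from n u) \<Longrightarrow> t \<in> letters (tag_from n u) \<Longrightarrow> snd s = snd t \<Longrightarrow> s = t"
  by (induction u arbitrary: n) (fastforce dest: letters_tag)+

lemma swappable_iff:
  "swappable x i j \<longleftrightarrow>
     (\<exists>u s t. swap_equiv (tag_from 0 x) u \<and> snd s = i \<and> snd t = j \<and> adjacent u s t)"
  unfolding swappable_def swap_equiv_iff_formally_equiv adjacent_def by blast

text \<open>Carrying out the swap leaves the two letters adjacent in the opposite order.\<close>

lemma swappable_sym:
  assumes "swappable x i j"
  shows "swappable x j i"
proof -
  obtain u s t where u: "swap_equiv (tag_from 0 x) u" "snd s = i" "snd t = j" "adjacent u s t"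
    using assms unfolding swappable_iff by blast
  have "swap_equiv (tag_from 0 x) (map_bword (transpose s t) u)"
    using u(1) adjacent_swap_step[OF u(4) swap_equiv_distinct_letters[OF u(1) distinct_letters_tag]]
    by (rule rtranclp.rtrancl_into_rtrancl)
  moreover have "adjacent (map_bword (transpose s t) u) t s"
    using adjacent_map[OF u(4), of "transpose s t"] by simp
  ultimately show ?thesis
    using u unfolding swappable_iff by blast
qed

text \<open>If \<open>s\<close> stands next to \<open>t\<close>, and \<open>t\<close> can be
  exchanged with \<open>r\<close>, then exchanging them puts \<open>r\<close> next to
  \<open>s\<close>. The positions \<open>i\<close> and \<open>k\<close> must differ since no
  occurrence is swappable with itself.\<close>

lemma swappable_trans:
  assumes "swappable x i j" and "swappable x j k" and "i \<noteq> k"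
  shows "swappable x i k"
proof -
  let ?w = "tag_from 0 x"
  obtain u s t where u: "swap_equiv ?w u" "snd s = i" "snd t = j" "adjacent u s t"
    using assms(1) unfolding swappable_iff by blast
  obtain u' t' r where u': "swap_equiv ?w u'" "snd t' = j" "snd r = k" "adjacent u' t' r"
    using assms(2) unfolding swappable_iff by blast
  \<comment> \<open>Both carry the tag \<open>j\<close>; tags are unique in \<open>?w\<close>, and
    swaps preserve the set of letters.\<close>
  have "t' = t"
  proof (rule tag_inj)
    show "t' \<in> letters ?w" "t \<in> letters ?w"
      using adjacent_letters[OF u(4)] adjacent_letters[OF u'(4)]
        swap_equiv_letters[OF u(1)] swap_equiv_letters[OF u'(1)] by auto
  qed (simp add: u(3) u'(2))
  let ?f = "transpose t r"
  have "s \<noteq> t" "s \<noteq> r"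
    using u u' assms(3) adjacent_neq[OF u(4) swap_equiv_distinct_letters[OF u(1) distinct_letters_tag]]
    by auto
  then have "adjacent (map_bword ?f u) s r"
    using adjacent_map[OF u(4), of ?f] by simp
  \<comment> \<open>The chain goes from \<open>?w\<close> to its relabelling, then along the
    relabelled chain from \<open>?w\<close> to \<open>u\<close>.\<close>
  moreover have "swap_equiv ?w (map_bword ?f u)"
    using adjacent_transpose_equiv[OF u'(1,4) distinct_letters_tag] swap_equiv_map[OF u(1)]
    unfolding \<open>t' = t\<close> by (rule rtranclp_trans)
  ultimately show ?thesis
    using u(2) u'(3) unfolding swappable_iff by blast
qed

section \<open>Classes of pairwise swappable positions\<close>

text \<open>Swappability is irreflexive; its reflexive closure is an honest equivalence
  relation.\<close>

definition same_class :: "'a bword \<Rightarrow> nat \<Rightarrow> nat \<Rightarrow> bool" where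
  "same_class x i j \<longleftrightarrow> i = j \<or> swappable x i j"

lemma same_class_refl [simp]: "same_class x i i"
  by (simp add: same_class_def)

lemma same_class_sym: "same_class x i j \<Longrightarrow> same_class x j i"
  by (auto simp: same_class_def intro: swappable_sym)

lemma same_class_trans [trans]: "same_class x i j \<Longrightarrow> same_class x j k \<Longrightarrow> same_class x i k"
  by (auto simp: same_class_def intro: swappable_trans)

lemma pairwise_swappable_iff:
  "pairwise_swappable x C \<longleftrightarrow> C \<subseteq> {..<len x} \<and> (\<forall>i\<in>C. \<forall>j\<in>C. same_class x i j)"
  unfolding pairwise_swappable_def same_class_def by blast

text \<open>By symmetry and transitivity, comparison with a single reference position
  \<open>a\<close> suffices.\<close>

lemma pairwise_swappableI:
  assumes "C \<subseteq> {..<len x}" and "\<And>i. i \<in> C \<Longrightarrow> same_class x a i"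
  shows "pairwise_swappable x C"
proof -
  have "same_class x i j" if "i \<in> C" "j \<in> C" for i j
    using same_class_trans[OF same_class_sym[OF assms(2)] assms(2)] that by blast
  then show ?thesis
    using assms(1) by (simp add: pairwise_swappable_iff)
qed

lemma swap_classesD: "C \<in> swap_classes x \<Longrightarrow> pairwise_swappable x D \<Longrightarrow> C \<subseteq> D \<Longrightarrow> D = C"
  by (simp add: swap_classes_def)

lemma swap_classes_pairwise_swappable: "C \<in> swap_classes x \<Longrightarrow> pairwise_swappable x C"
  by (simp add: swap_classes_def)

text \<open>If all positions form one clique, it is the only maximal one. Otherwise a clique
  contained in neither \<open>A\<close> nor \<open>B\<close> would link all positions, so every
  clique lies in \<open>A\<close> or \<open>B\<close>, and a maximal one equals it.\<close>

lemma card_swap_classes_le_2: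
  assumes A: "pairwise_swappable x A" and B: "pairwise_swappable x B"
    and cover: "{..<len x} \<subseteq> A \<union> B"
  shows "card (swap_classes x) \<le> 2"
proof (cases "pairwise_swappable x {..<len x}")
  case True
  have "swap_classes x \<subseteq> {{..<len x}}"
  proof
    fix C
    assume C: "C \<in> swap_classes x"
    then have "C \<subseteq> {..<len x}"
      using swap_classes_pairwise_swappable unfolding pairwise_swappable_def by blast
    then show "C \<in> {{..<len x}}"
      using swap_classesD[OF C True] by simp
  qed
  then have "card (swap_classes x) \<le> card {{..<len x}}"
    by (intro card_mono) auto
  then show ?thesis
    by simp
next
  case False
  have *: "C \<subseteq> A \<or> C \<subseteq> B" if C: "pairwise_swappable x C" for C
  proof (rule ccontr)
    assume "\<not> (C \<subseteq> A \<or> C \<subseteq> B)"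
    \<comment> \<open>An element of \<open>C\<close> outside \<open>B\<close> lies in
      \<open>A\<close> by the cover, and one outside \<open>A\<close> lies in
      \<open>B\<close>.\<close>
    then obtain c d where cd: "c \<in> C" "c \<in> A" "d \<in> C" "d \<in> B"
      using C cover unfolding pairwise_swappable_def by blast
    then have "same_class x c d"
      using C by (simp add: pairwise_swappable_iff)
    have "same_class x c i" if "i < len x" for i
    proof (cases "i \<in> A")
      case True
      then show ?thesis
        using A cd by (simp add: pairwise_swappable_iff)
    next
      case False
      then have "i \<in> B"
        using that cover by auto
      then have "same_class x d i"
        using B cd by (simp add: pairwise_swappable_iff)
      with \<open>same_class x c d\<close> show ?thesis
        by (rule same_class_trans)
    qed
    then show False
      using False pairwise_swappableI[of "{..<len x}" x c] by simp
  qed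
  have "swap_classes x \<subseteq> {A, B}"
  proof
    fix C
    assume C: "C \<in> swap_classes x"
    then have "C \<subseteq> A \<or> C \<subseteq> B"
      using * swap_classes_pairwise_swappable by blast
    then show "C \<in> {A, B}"
      using swap_classesD[OF C A] swap_classesD[OF C B] by auto
  qed
  then have "card (swap_classes x) \<le> card {A, B}"
    by (intro card_mono) auto
  also have "\<dots> \<le> 2"
    by (simp add: card_insert_if)
  finally show ?thesis .
qed

section \<open>Left-normed times right-normed words\<close>

lemma left_normed_1 [simp]: "left_normed x (Suc 0) = Letter (x 1)"
  by (simp add: left_normed_def)

lemma left_normed_Suc: "k \<ge> 1 \<Longrightarrow> left_normed x (Suc k) = left_normed x k \<odot> Letter (x (Suc k))"
  by (simp add: left_normed_def)

lemma right_normed_1 [simp]: "right_normed y (Suc 0) = Letter (y 1)"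
  by (simp add: right_normed_def)

lemma right_normed_Suc: "n \<ge> 1 \<Longrightarrow> right_normed y (Suc n) = Letter (y (Suc n)) \<odot> right_normed y n"
  by (simp add: right_normed_def)

lemma len_left_normed: "k \<ge> 1 \<Longrightarrow> len (left_normed x k) = k"
  by (induction k rule: dec_induct) (auto simp: left_normed_Suc)

lemma len_right_normed: "n \<ge> 1 \<Longrightarrow> len (right_normed y n) = n"
  by (induction n rule: dec_induct) (auto simp: right_normed_Suc)

text \<open>Lengthens the word by one letter: the changed index \<open>Suc k\<close> lies beyond
  those read by \<open>left_normed x k\<close>.\<close>

lemma left_normed_update: "k \<ge> 1 \<Longrightarrow> left_normed (x(Suc k := s)) (Suc k) = left_normed x k \<odot> Letter s"
proof -
  assume "k \<ge> 1"
  moreover have "map (x(Suc k := s)) [2..<Suc k] = map x [2..<Suc k]"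
    by (rule map_cong) auto
  ultimately show ?thesis
    by (simp add: left_normed_Suc del: upt_Suc) (simp add: left_normed_def del: upt_Suc)
qed

lemma right_normed_update:
  "n \<ge> 1 \<Longrightarrow> right_normed (y(Suc n := s)) (Suc n) = Letter s \<odot> right_normed y n"
proof -
  assume "n \<ge> 1"
  moreover have "map (y(Suc n := s)) [2..<Suc n] = map y [2..<Suc n]"
    by (rule map_cong) auto
  ultimately show ?thesis
    by (simp add: right_normed_Suc del: upt_Suc) (simp add: right_normed_def del: upt_Suc)
qed

lemma tag_left_normed:
  "k \<ge> 1 \<Longrightarrow> tag_from 0 (left_normed x k) = left_normed (\<lambda>i. (x i, x_pos i)) k"
  by (induction k rule: dec_induct) (auto simp: left_normed_Suc len_left_normed x_pos_def)

lemma tag_right_normed: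
  "n \<ge> 1 \<Longrightarrow> tag_from k (right_normed y n) = right_normed (\<lambda>j. (y j, k + n - j)) n"
proof (induction n arbitrary: k rule: dec_induct)
  case (step n)
  then show ?case
    \<comment> \<open>The new outermost letter takes position \<open>k\<close>, so the remaining
      factor is tagged from \<open>Suc k\<close>.\<close>
    using step.IH[of "Suc k"] by (simp add: right_normed_Suc)
qed simp

text \<open>Each left swap pulls the outermost \<open>y\<close> letter in front of \<open>z\<close>;
  after all but \<open>y 1\<close> are out, \<open>z\<close> is multiplied by \<open>y 1\<close>
  alone.\<close>

lemma swap_equiv_inner_left:
  "n \<ge> 1 \<Longrightarrow> \<exists>u. swap_equiv (z \<odot> right_normed y n) u \<and> z \<odot> Letter (y 1) \<in> subwords u"
proof (induction n rule: dec_induct)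
  case base
  show ?case
    by (rule exI[of _ "z \<odot> Letter (y 1)"]) simp
next
  case (step n)
  then obtain u where u: "swap_equiv (z \<odot> right_normed y n) u" "z \<odot> Letter (y 1) \<in> subwords u"
    by blast
  have "swap_equiv (z \<odot> right_normed y (Suc n)) (Letter (y (Suc n)) \<odot> u)"
    using step.hyps swap_equiv_mult_left[OF u(1)]
    by (auto simp: right_normed_Suc intro: converse_rtranclp_into_rtranclp swap_left)
  moreover have "z \<odot> Letter (y 1) \<in> subwords (Letter (y (Suc n)) \<odot> u)"
    using u(2) by simp
  ultimately show ?case
    by blast
qed

text \<open>The mirror image: right swaps move all \<open>x\<close> letters except
  \<open>x 1\<close> behind \<open>z\<close>.\<close>

lemma swap_equiv_inner_right:
  "k \<ge> 1 \<Longrightarrow> \<exists>u. swap_equiv (left_normed x k \<odot> z) u \<and> Letter (x 1) \<odot> z \<in> subwords u"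
proof (induction k rule: dec_induct)
  case base
  show ?case
    by (rule exI[of _ "Letter (x 1) \<odot> z"]) simp
next
  case (step k)
  then obtain u where u: "swap_equiv (left_normed x k \<odot> z) u" "Letter (x 1) \<odot> z \<in> subwords u"
    by blast
  have "swap_equiv (left_normed x (Suc k) \<odot> z) (u \<odot> Letter (x (Suc k)))"
    using step.hyps swap_equiv_mult_right[OF u(1)]
    by (auto simp: left_normed_Suc intro: converse_rtranclp_into_rtranclp swap_right)
  moreover have "Letter (x 1) \<odot> z \<in> subwords (u \<odot> Letter (x (Suc k)))"
    using u(2) by simp
  ultimately show ?case
    by blast
qed

lemma left_normed_subwords: "1 \<le> i \<Longrightarrow> i \<le> k \<Longrightarrow> left_normed x i \<in> subwords (left_normed x k)"
  by (rotate_tac, induction k rule: dec_induct) (auto simp: left_normed_Suc)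

lemma right_normed_subwords: "1 \<le> i \<Longrightarrow> i \<le> n \<Longrightarrow> right_normed y i \<in> subwords (right_normed y n)"
  by (rotate_tac, induction n rule: dec_induct) (auto simp: right_normed_Suc)

lemma adjacent_left_normed:
  assumes "2 \<le> i" and "i < k"
  shows "adjacent (left_normed x k) (x (Suc i)) (x i)"
proof -
  \<comment> \<open>The bound \<open>2 \<le> i\<close> leaves a nonempty prefix
    \<open>left_normed x j\<close> to serve as the word \<open>v\<close> in
    \<open>adjacent\<close>.\<close>
  obtain j where j: "i = Suc j" "j \<ge> 1"
    using assms(1) by (cases i) auto
  have "(left_normed x j \<odot> Letter (x i)) \<odot> Letter (x (Suc i)) \<in> subwords (left_normed x k)"
    using left_normed_subwords[of "Suc i" k x] assms j by (simp add: left_normed_Suc)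
  then show ?thesis
    unfolding adjacent_def by blast
qed

lemma adjacent_right_normed:
  assumes "2 \<le> i" and "i < n"
  shows "adjacent (right_normed y n) (y (Suc i)) (y i)"
proof -
  obtain j where j: "i = Suc j" "j \<ge> 1"
    using assms(1) by (cases i) auto
  have "Letter (y (Suc i)) \<odot> (Letter (y i) \<odot> right_normed y j) \<in> subwords (right_normed y n)"
    using right_normed_subwords[of "Suc i" n y] assms j by (simp add: right_normed_Suc)
  then show ?thesis
    unfolding adjacent_def by blast
qed

section \<open>Swappable letters of a fixed product\<close>

context
  fixes k n m :: nat and x y :: "nat \<Rightarrow> 'a" and xy :: "'a bword"
  assumes k: "k \<ge> 1" and n: "n \<ge> 1" and m: "m = k + n"
    and xy: "xy = left_normed x k \<odot> right_normed y n"
begin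

lemma len_left_right_normed: "len xy = m"
  using k n m by (simp add: xy len_left_normed len_right_normed)

lemma tag_left_right_normed:
  "tag_from 0 xy =
     left_normed (\<lambda>i. (x i, x_pos i)) k \<odot> right_normed (\<lambda>j. (y j, y_pos m j)) n"
  using k n m by (simp add: xy tag_left_normed tag_right_normed len_left_normed y_pos_def)

lemma swappable_left_normed:
  assumes "2 \<le> i" and "i < k"
  shows "swappable xy (x_pos (Suc i)) (x_pos i)"
proof -
  have "adjacent (tag_from 0 xy) (x (Suc i), x_pos (Suc i)) (x i, x_pos i)"
    unfolding tag_left_right_normed
    by (rule adjacent_subwords[OF adjacent_left_normed[OF assms]]) simp
  then show ?thesis
    unfolding swappable_iff by force
qed

lemma swappable_right_normed:
  assumes "2 \<le> j" and "j < n"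
  shows "swappable xy (y_pos m (Suc j)) (y_pos m j)"
proof -
  have "adjacent (tag_from 0 xy) (y (Suc j), y_pos m (Suc j)) (y j, y_pos m j)"
    unfolding tag_left_right_normed
    by (rule adjacent_subwords[OF adjacent_right_normed[OF assms]]) simp
  then show ?thesis
    unfolding swappable_iff by force
qed

lemma swappable_first_right:
  assumes "2 \<le> k"
  shows "swappable xy (y_pos m 1) (x_pos k)"
proof -
  obtain l where l: "k = Suc l" "l \<ge> 1"
    using assms by (cases k) auto
  let ?x = "\<lambda>i. (x i, x_pos i)" and ?y = "\<lambda>j. (y j, y_pos m j)"
  obtain u where u: "swap_equiv (tag_from 0 xy) u"
      "left_normed ?x k \<odot> Letter (?y 1) \<in> subwords u"
    unfolding tag_left_right_normed using swap_equiv_inner_left[OF n] by blast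
  \<comment> \<open>Since \<open>k\<close> is at least 2, the left factor is
    \<open>left_normed ?x l\<close> times \<open>?x k\<close>, and \<open>?y 1\<close> now follows
    directly.\<close>
  have "adjacent u (?y 1) (?x k)"
    using u(2) l unfolding adjacent_def by (auto simp: left_normed_Suc)
  then show ?thesis
    using u(1) unfolding swappable_iff by force
qed

lemma swappable_first_left:
  assumes "2 \<le> n"
  shows "swappable xy (x_pos 1) (y_pos m n)"
proof -
  obtain l where l: "n = Suc l" "l \<ge> 1"
    using assms by (cases n) auto
  let ?x = "\<lambda>i. (x i, x_pos i)" and ?y = "\<lambda>j. (y j, y_pos m j)"
  obtain u where u: "swap_equiv (tag_from 0 xy) u"
      "Letter (?x 1) \<odot> right_normed ?y n \<in> subwords u"
    unfolding tag_left_right_normed using swap_equiv_inner_right[OF k] by blast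
  have "adjacent u (?x 1) (?y n)"
    using u(2) l unfolding adjacent_def by (auto simp: right_normed_Suc)
  then show ?thesis
    using u(1) unfolding swappable_iff by force
qed

lemma pairwise_swappable_left: "pairwise_swappable xy (insert (y_pos m 1) (x_pos ` {2..k}))"
proof (rule pairwise_swappableI)
  show "insert (y_pos m 1) (x_pos ` {2..k}) \<subseteq> {..<len xy}"
    using k n m by (auto simp: len_left_right_normed x_pos_def y_pos_def)
  \<comment> \<open>\<open>y 1\<close> is linked to \<open>x k\<close> first, then downwards through
    neighbouring letters to \<open>x 2\<close>. For \<open>k = 1\<close> the claim is
    vacuous.\<close>
  have "same_class xy (y_pos m 1) (x_pos i)" if "i \<le> k" "2 \<le> i" for i
    using that
  proof (induction rule: inc_induct)
    case base
    then show ?case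
      by (simp add: same_class_def swappable_first_right[simplified])
  next
    case (step i)
    have "same_class xy (y_pos m 1) (x_pos (Suc i))"
      using step by simp
    also have "same_class xy (x_pos (Suc i)) (x_pos i)"
      using step by (simp add: same_class_def swappable_left_normed)
    finally show ?case .
  qed
  then show "same_class xy (y_pos m 1) i" if "i \<in> insert (y_pos m 1) (x_pos ` {2..k})" for i
    using that by auto
qed

lemma pairwise_swappable_right: "pairwise_swappable xy (insert (x_pos 1) (y_pos m ` {2..n}))"
proof (rule pairwise_swappableI)
  show "insert (x_pos 1) (y_pos m ` {2..n}) \<subseteq> {..<len xy}"
    using k n m by (auto simp: len_left_right_normed x_pos_def y_pos_def)
  have "same_class xy (x_pos 1) (y_pos m j)" if "j \<le> n" "2 \<le> j" for j
    using that
  proof (induction rule: inc_induct)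
    case base
    then show ?case
      by (simp add: same_class_def swappable_first_left[simplified])
  next
    case (step j)
    have "same_class xy (x_pos 1) (y_pos m (Suc j))"
      using step by simp
    also have "same_class xy (y_pos m (Suc j)) (y_pos m j)"
      using step by (simp add: same_class_def swappable_right_normed)
    finally show ?case .
  qed
  then show "same_class xy (x_pos 1) i" if "i \<in> insert (x_pos 1) (y_pos m ` {2..n})" for i
    using that by auto
qed

lemma card_swap_classes_left_right_normed: "card (swap_classes xy) \<le> 2"
proof (rule card_swap_classes_le_2[OF pairwise_swappable_left pairwise_swappable_right], rule subsetI)
  fix p
  assume "p \<in> {..<len xy}"
  then have "p < m"
    by (simp add: len_left_right_normed)
  \<comment> \<open>These are the positions of \<open>y 1\<close>, of \<open>x 1\<close>, of
    \<open>x (Suc p)\<close>, and of \<open>y (m - p)\<close>.\<close>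
  consider "p = m - 1" | "p = 0" | "1 \<le> p" "p < k" | "k \<le> p" "p < m - 1"
    using \<open>p < m\<close> by linarith
  then show "p \<in> insert (y_pos m 1) (x_pos ` {2..k}) \<union> insert (x_pos 1) (y_pos m ` {2..n})"
  proof cases
    case 3
    then have "p \<in> x_pos ` {2..k}"
      by (intro image_eqI[of _ _ "Suc p"]) (auto simp: x_pos_def)
    then show ?thesis
      by blast
  next
    case 4
    then have "p \<in> y_pos m ` {2..n}"
      using m by (intro image_eqI[of _ _ "m - p"]) (auto simp: y_pos_def)
    then show ?thesis
      by blast
  qed (auto simp: x_pos_def y_pos_def)
qed

end

section \<open>Reduction of one-sided words to the normal form\<close>

lemma one_sided_words_swap_equiv:
  assumes "w \<in> one_sided_words S m" and "m \<ge> 2"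
  shows "\<exists>k n x y. 1 \<le> k \<and> 1 \<le> n \<and> m = k + n \<and> x ` {1..k} \<subseteq> S \<and> y ` {1..n} \<subseteq> S
           \<and> swap_equiv w (left_normed x k \<odot> right_normed y n)"
  using assms(2,1)
proof (induction m arbitrary: w rule: dec_induct)
  case base
  have "one_sided_words S 2 = {Letter s \<odot> Letter t |s t. s \<in> S \<and> t \<in> S}"
    by (auto simp: numeral_2_eq_2)
  then obtain s t where "s \<in> S" "t \<in> S" "w = Letter s \<odot> Letter t"
    using base by blast
  then show ?case
    by - (rule exI[of _ 1], rule exI[of _ 1], rule exI[of _ "\<lambda>_. s"],
        rule exI[of _ "\<lambda>_. t"], auto)
next
  case (step m)
  \<comment> \<open>The recursive equation of \<open>one_sided_words\<close> applies only at a
    double successor.\<close>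
  obtain l where l: "m = Suc l"
    using step.hyps by (cases m) auto
  obtain u s where u: "u \<in> one_sided_words S m" "s \<in> S"
      and w: "w = u \<odot> Letter s \<or> w = Letter s \<odot> u"
  proof -
    have "w \<in> {u \<odot> Letter s |u s. u \<in> one_sided_words S m \<and> s \<in> S}
        \<union> {Letter s \<odot> u |u s. u \<in> one_sided_words S m \<and> s \<in> S}"
      using step.prems by (simp add: l)
    then show ?thesis
      using that by blast
  qed
  obtain k n x y where IH: "1 \<le> k" "1 \<le> n" "m = k + n" "x ` {1..k} \<subseteq> S" "y ` {1..n} \<subseteq> S"
      "swap_equiv u (left_normed x k \<odot> right_normed y n)"
    using step.IH[OF u(1)] by (elim exE conjE) (rule that)
  from w show ?case
  proof
    assume "w = u \<odot> Letter s"
    then have "swap_equiv w ((left_normed x k \<odot> right_normed y n) \<odot> Letter s)"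
      using swap_equiv_mult_right[OF IH(6)] by simp
    then have "swap_equiv w (left_normed (x(Suc k := s)) (Suc k) \<odot> right_normed y n)"
      unfolding left_normed_update[OF IH(1)] by (rule rtranclp.rtrancl_into_rtrancl) (rule swap_right)
    moreover have "x(Suc k := s) ` {1..Suc k} \<subseteq> S"
      using IH(4) u(2) by (auto simp: le_Suc_eq)
    moreover have "1 \<le> Suc k" "Suc m = Suc k + n"
      using IH(3) by auto
    ultimately show ?thesis
      using IH(2,5) by - (rule exI[of _ "Suc k"], rule exI[of _ n],
          rule exI[of _ "x(Suc k := s)"], rule exI[of _ y], blast)
  next
    assume "w = Letter s \<odot> u"
    then have "swap_equiv w (Letter s \<odot> (left_normed x k \<odot> right_normed y n))"
      using swap_equiv_mult_left[OF IH(6)] by simp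
    then have "swap_equiv w (left_normed x k \<odot> right_normed (y(Suc n := s)) (Suc n))"
      unfolding right_normed_update[OF IH(2)] by (rule rtranclp.rtrancl_into_rtrancl) (rule swap_left)
    moreover have "y(Suc n := s) ` {1..Suc n} \<subseteq> S"
      using IH(5) u(2) by (auto simp: le_Suc_eq)
    moreover have "1 \<le> Suc n" "Suc m = k + Suc n"
      using IH(3) by auto
    ultimately show ?thesis
      using IH(1,4) by - (rule exI[of _ k], rule exI[of _ "Suc n"],
          rule exI[of _ x], rule exI[of _ "y(Suc n := s)"], blast)
  qed
qed

section \<open>Formally equivalent words are equivalent\<close>

lemma len_pos: "1 \<le> len u"
  by (induction u) auto

context nonassoc_algebra
begin

lemma mult_linear [simp]:
  "mult (a + b) c = mult a c + mult b c" "mult a (b + c) = mult a b + mult a c"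
  "mult (scale r a) c = scale r (mult a c)" "mult a (scale r c) = scale r (mult a c)"
  "mult 0 c = 0" "mult a 0 = 0"
  "mult (- a) c = - mult a c" "mult a (- c) = - mult a c"
  "mult (a - b) c = mult a c - mult b c" "mult a (b - c) = mult a b - mult a c"
proof -
  have left: "module_hom scale scale (\<lambda>x. mult x y)" for y
    using linear_mult_left by (simp add: linear_iff_module_hom)
  have right: "module_hom scale scale (mult y)" for y
    using linear_mult_right by (simp add: linear_iff_module_hom)
  show "mult (a + b) c = mult a c + mult b c" "mult a (b + c) = mult a b + mult a c"
    by (fact module_hom.add[OF left] module_hom.add[OF right])+
  show "mult (scale r a) c = scale r (mult a c)" "mult a (scale r c) = scale r (mult a c)"
    by (fact module_hom.scale[OF left] module_hom.scale[OF right])+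
  show "mult 0 c = 0" "mult a 0 = 0"
    by (fact module_hom.zero[OF left] module_hom.zero[OF right])+
  show "mult (- a) c = - mult a c" "mult a (- c) = - mult a c"
    by (fact module_hom.neg[OF left] module_hom.neg[OF right])+
  show "mult (a - b) c = mult a c - mult b c" "mult a (b - c) = mult a b - mult a c"
    by (fact module_hom.diff[OF left] module_hom.diff[OF right])+
qed

section \<open>Spans of words and their products\<close>

lemma words_span_add: "p \<in> words_span scale mult k S \<Longrightarrow> q \<in> words_span scale mult k S \<Longrightarrow>
    p + q \<in> words_span scale mult k S"
  unfolding words_span_def unital_span_def by (rule span_add)

lemma words_span_neg: "p \<in> words_span scale mult k S \<Longrightarrow> - p \<in> words_span scale mult k S"
  unfolding words_span_def unital_span_def by (rule span_neg)

lemma words_span_0: "0 \<in> words_span scale mult k S"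
  unfolding words_span_def unital_span_def by (rule span_zero)

lemma words_span_val:
  "letters u \<subseteq> S \<Longrightarrow> len u \<le> k \<Longrightarrow> val mult u \<in> words_span scale mult k S"
  unfolding words_span_def unital_span_def by (rule span_base) auto

lemma unital_span_subset_words_span:
  assumes "A \<subseteq> words_span scale mult k S"
  shows "unital_span scale mult A \<subseteq> words_span scale mult k S"
  using assms unfolding words_span_def unital_span_def
  by (intro span_minimal) (auto intro: span_base)

text \<open>The unity needs its own case because no \<open>bword\<close> represents the word of
  length 0.\<close>

lemma words_span_induct [consumes 1, case_names val unity zero add scale]:
  assumes "p \<in> words_span scale mult k S"
    and "\<And>u. letters u \<subseteq> S \<Longrightarrow> len u \<le> k \<Longrightarrow> P (val mult u)"
    and "\<And>e. e \<in> unity mult \<Longrightarrow> P e"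
    and "P 0"
    and "\<And>a b. P a \<Longrightarrow> P b \<Longrightarrow> P (a + b)"
    and "\<And>r a. P a \<Longrightarrow> P (scale r a)"
  shows "P p"
  using assms(1) unfolding words_span_def unital_span_def
proof (induction rule: span_induct_alt)
  case base
  then show ?case by (rule assms(4))
next
  case (step c a b)
  then have "P a"
    using assms(2,3) by auto
  then show ?case
    using step assms(5,6) by blast
qed

lemma words_span_scale: "p \<in> words_span scale mult k S \<Longrightarrow> scale r p \<in> words_span scale mult k S"
  unfolding words_span_def unital_span_def by (rule span_scale)

text \<open>By linearity only generators matter: a word times \<open>z\<close> is a word of the
  added length, and the unity times \<open>z\<close> is \<open>z\<close> itself.\<close>

lemma words_span_mult_right:
  assumes "p \<in> words_span scale mult k S" and "letters z \<subseteq> S"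
  shows "mult p (val mult z) \<in> words_span scale mult (k + len z) S"
  using assms(1)
proof (induction rule: words_span_induct)
  case (val u)
  then show ?case
    using words_span_val[of "u \<odot> z"] assms(2) by simp
next
  case (unity e)
  then show ?case
    using words_span_val[OF assms(2)] by (simp add: unity_def)
qed (simp_all add: words_span_0 words_span_add words_span_scale)

lemma words_span_mult_left:
  assumes "p \<in> words_span scale mult k S" and "letters z \<subseteq> S"
  shows "mult (val mult z) p \<in> words_span scale mult (len z + k) S"
  using assms(1)
proof (induction rule: words_span_induct)
  case (val u)
  then show ?case
    using words_span_val[of "z \<odot> u"] assms(2) by simp
next
  case (unity e)
  then show ?case
    using words_span_val[OF assms(2)] by (simp add: unity_def)
qed (simp_all add: words_span_0 words_span_add words_span_scale)

lemma sval_mult_right: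
  "sval mult (map_signed (\<lambda>x. x \<odot> z) p) = mult (sval mult p) (val mult z)"
  by (cases p) auto

lemma sval_mult_left:
  "sval mult (map_signed (\<lambda>x. z \<odot> x) p) = mult (val mult z) (sval mult p)"
  by (cases p) auto

lemma word_equiv_refl: "letters (unsigned p) \<subseteq> S \<Longrightarrow> word_equiv scale mult S p p"
  by (simp add: word_equiv_def words_span_0)

lemma word_equiv_sym: "word_equiv scale mult S p q \<Longrightarrow> word_equiv scale mult S q p"
  unfolding word_equiv_def using words_span_neg[of "sval mult p - sval mult q"] by force

lemma word_equiv_trans:
  "word_equiv scale mult S p q \<Longrightarrow> word_equiv scale mult S q r \<Longrightarrow> word_equiv scale mult S p r"
  unfolding word_equiv_def
  using words_span_add[of "sval mult p - sval mult q" _ S "sval mult q - sval mult r"] by force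

text \<open>Every generator omits at least one of the three words, each of length at least 1, and so
  is shorter than their full product.\<close>

lemma words_span_of_triple:
  assumes "letters a \<subseteq> S" "letters b \<subseteq> S" "letters c \<subseteq> S"
  shows "unital_span scale mult
      {val mult a, val mult b, val mult c, mult (val mult a) (val mult b),
       mult (val mult b) (val mult a), mult (val mult c) (val mult b),
       mult (val mult b) (val mult c), mult (val mult a) (val mult c),
       mult (val mult c) (val mult a)}
    \<subseteq> words_span scale mult (len a + len b + len c - 1) S"
proof (rule unital_span_subset_words_span)
  let ?W = "words_span scale mult (len a + len b + len c - 1) S"
  have short: "val mult u \<in> ?W" if "letters u \<subseteq> S" "len u < len a + len b + len c" for u
    using that by (intro words_span_val) auto
  have prod: "mult (val mult u) (val mult v) \<in> ?W"
    if "letters u \<subseteq> S" "letters v \<subseteq> S" "len u + len v < len a + len b + len c" for u v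
    using short[of "u \<odot> v"] that by simp
  show "{val mult a, val mult b, val mult c, mult (val mult a) (val mult b),
       mult (val mult b) (val mult a), mult (val mult c) (val mult b),
       mult (val mult b) (val mult c), mult (val mult a) (val mult c),
       mult (val mult c) (val mult a)} \<subseteq> ?W"
    using assms len_pos[of a] len_pos[of b] len_pos[of c] by (auto intro!: short prod simp del: One_nat_def)
qed

text \<open>The generating swaps are the two sum conditions of descending alternativity, the minus
  sign turning the difference into a sum. Multiplying by \<open>z\<close> raises the span degree by
  exactly \<open>len z\<close>.\<close>

lemma elementary_imp_word_equiv:
  assumes "descendingly_alternative scale mult"
  shows "elementary p q \<Longrightarrow> letters (unsigned p) \<subseteq> S \<Longrightarrow> word_equiv scale mult S p q"
proof (induction rule: elementary.induct)
  case (right_swap a b c)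
  then show ?case
    using assms words_span_of_triple[of a S b c]
    unfolding word_equiv_def descendingly_alternative_def Let_def by (auto simp: add_ac)
next
  case (left_swap a b c)
  then show ?case
    using assms words_span_of_triple[of a S b c]
    unfolding word_equiv_def descendingly_alternative_def Let_def by (auto simp: add_ac)
next
  case (mult_right p q z)
  then have "word_equiv scale mult S p q" and z: "letters z \<subseteq> S"
    by (auto)
  then show ?case
    \<comment> \<open>Positivity of the length makes \<open>(len (unsigned p) - 1) + len z\<close>
      equal to the length of the product minus 1, despite truncated subtraction.\<close>
    using words_span_mult_right[OF _ z, of "sval mult p - sval mult q" "len (unsigned p) - 1"]
      len_pos[of "unsigned p"]
    by (auto simp: word_equiv_def sval_mult_right)
next
  case (mult_left p q z)
  then have "word_equiv scale mult S p q" and z: "letters z \<subseteq> S"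
    by (auto)
  then show ?case
    using words_span_mult_left[OF _ z, of "sval mult p - sval mult q" "len (unsigned p) - 1"]
      len_pos[of "unsigned p"]
    by (auto simp: word_equiv_def sval_mult_left)
qed

lemma formally_equiv_imp_word_equiv:
  assumes da: "descendingly_alternative scale mult"
    and "formally_equiv p q" and "letters (unsigned p) \<subseteq> S"
  shows "word_equiv scale mult S p q"
  using assms(2,3) unfolding formally_equiv_def
proof (induction rule: equivclp_induct)
  case base
  then show ?case
    by (rule word_equiv_refl)
next
  case (step q r)
  then have pq: "word_equiv scale mult S p q"
    by blast
  then have "letters (unsigned q) \<subseteq> S"
    by (simp add: word_equiv_def)
  \<comment> \<open>The step may run from \<open>r\<close> to \<open>q\<close>; the lemma on
    elementary equivalences then needs the letters of \<open>r\<close> in \<open>S\<close>.\<close>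
  moreover from this have "letters (unsigned r) \<subseteq> S"
    using step.hyps(2) by (metis elementary_imp_swap_step swap_step_letters)
  ultimately have "word_equiv scale mult S q r"
    using step.hyps(2) elementary_imp_word_equiv[OF da] word_equiv_sym by blast
  with pq show ?case
    by (rule word_equiv_trans)
qed

text \<open>Dropping signs loses only the sign of the final word, hence the two
  alternatives.\<close>

lemma swap_equiv_imp_word_equiv:
  assumes "descendingly_alternative scale mult"
    and "swap_equiv u v" and "letters u \<subseteq> S"
  shows "word_equiv scale mult S (Plus u) (Plus v) \<or> word_equiv scale mult S (Plus u) (Minus v)"
proof -
  obtain p where "formally_equiv (Plus u) p" "unsigned p = v"
    using assms(2) unfolding swap_equiv_iff_formally_equiv by blast
  then show ?thesis
    using formally_equiv_imp_word_equiv[OF assms(1), of "Plus u" p S] assms(3) by (cases p) auto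
qed

end

lemma letters_one_sided_words: "w \<in> one_sided_words S m \<Longrightarrow> letters w \<subseteq> S"
  by (induction S m arbitrary: w rule: one_sided_words.induct) fastforce+

theorem lemma4p1:
  fixes scale :: "'f::field \<Rightarrow> 'a::ab_group_add \<Rightarrow> 'a"
    and mult :: "'a \<Rightarrow> 'a \<Rightarrow> 'a"
    and Basis S :: "'a set"
    and m :: nat
    and w :: "'a bword"
  assumes "nonassoc_algebra scale mult"
    and "finite_dimensional_vector_space scale Basis"
    and "descendingly_alternative scale mult"
    and "m \<ge> 2"
    and "w \<in> one_sided_words S m"
  shows "\<exists>k x y xy.
     1 \<le> k \<and> k \<le> m - 1 \<and> (\<forall>i\<in>{1..k}. x i \<in> S) \<and> (\<forall>j\<in>{1..m - k}. y j \<in> S)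
     \<and> xy = left_normed x k \<odot> right_normed y (m - k)
     \<and> (word_equiv scale mult S (Plus w) (Plus xy) \<or> word_equiv scale mult S (Plus w) (Minus xy))
     \<and> card (swap_classes xy) \<le> 2
     \<and> pairwise_swappable xy (insert (y_pos m 1) (x_pos ` {2..k}))
     \<and> pairwise_swappable xy (insert (x_pos 1) (y_pos m ` {2..m - k}))"
proof -
  interpret nonassoc_algebra scale mult
    by fact
  obtain k n x y where *: "1 \<le> k" "1 \<le> n" "m = k + n" "x ` {1..k} \<subseteq> S" "y ` {1..n} \<subseteq> S"
      "swap_equiv w (left_normed x k \<odot> right_normed y n)"
    using one_sided_words_swap_equiv[OF assms(5,4)] by (elim exE conjE) (rule that)
  \<comment> \<open>The reduction works with \<open>m = k + n\<close> to avoid subtraction; the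
    claim is phrased with \<open>m - k\<close>.\<close>
  have n: "n = m - k"
    using *(3) by simp
  show ?thesis
    using * card_swap_classes_left_right_normed[OF *(1-3) refl, of x y]
      pairwise_swappable_left[OF *(1-3) refl, of x y]
      pairwise_swappable_right[OF *(1-3) refl, of x y]
      swap_equiv_imp_word_equiv[OF assms(3) *(6) letters_one_sided_words[OF assms(5)]]
    unfolding n
    by - (rule exI[of _ k], rule exI[of _ x], rule exI[of _ y],
        rule exI[of _ "left_normed x k \<odot> right_normed y (m - k)"], auto)
qed

end
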